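(* Let $p>0$ be a constant. There is a randomized two-pass node-arrival streaming algorithm that, given an input data stream $\sigma=(\sigma_1,\dots,\sigma_n)\in U^n$ of length $n$, a similarity function $f:U\times U\to[0,1]$, and any $\epsilon\in(0,1)$, computes a $(1+\epsilon,0.01)$-approximation of the degree moment $M_p(\sigma)=\sum_{i\in[n]} d_i^p$, using $O\left(\frac{1}{\epsilon^2}n^{1-1/(p+1)}\log n\right)$ words of space.
   Context: Similarity graph. $U$ is a universe of items and $f:U\times U\to[0,1]$ is a symmetric similarity function with $f(x,x)=1$ for all $x\in U$. For a stream $\sigma=(\sigma_1,\dots,\sigma_n)\in U^n$, the similarity graph $G^\sigma$ is the complete weighted graph (with self-loops) on node set $[n]$ with weights $w(i,j)=f(\sigma_i,\sigma_j)$. The degree of node $i$ is $d_i=\sum_{j\in[n]} f(\sigma_i,\sigma_j)$. Each stream position is a distinct node; node $i$ is represented by the pair $(i,\sigma_i)$. Node-arrival streaming model. The items $\sigma_1,\dots,\sigma_n$ arrive sequentially; a pass is one linear scan of the stream (the same order in each pass). Edge weights are not given; $f(x,y)$ may be evaluated on demand, but only when both items $x,y$ are in memory (the currently arriving item counts as being in memory). The algorithm is randomized and knows $n$ and $\epsilon$ in advance. Space is measured in words in a unit-cost RAM model: each stream item, each value returned by $f$ and each arithmetic quantity maintained takes $O(1)$ words. Since $p$ is a constant, the constant hidden in $O(\cdot)$ may depend on $p$. Approximation. For $\epsilon\in(0,1)$, $\tilde X$ is a $(1+\epsilon,\delta)$-approximation of $X$ if $(1-\epsilon)X\le\tilde X\le(1+\epsilon)X$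 with probability at least $1-\delta$. *)

theory Defs
  imports "HOL-Probability.Probability"
begin

section \<open>Similarity graph and degree moments\<close>

definition similarity :: "'u set \<Rightarrow> ('u \<Rightarrow> 'u \<Rightarrow> real) \<Rightarrow> bool" where
  "similarity U f \<longleftrightarrow>
     (\<forall>x\<in>U. f x x = 1) \<and>
     (\<forall>x\<in>U. \<forall>y\<in>U. f x y \<in> {0..1} \<and> f x y = f y x)"

text \<open>Nodes are the stream positions, numbered from 0.\<close>

definition weight :: "('u \<Rightarrow> 'u \<Rightarrow> real) \<Rightarrow> 'u list \<Rightarrow> nat \<Rightarrow> nat \<Rightarrow> real" where
  "weight f \<sigma> i j = f (\<sigma> ! i) (\<sigma> ! j)"

definition node_degree :: "('u \<Rightarrow> 'u \<Rightarrow> real) \<Rightarrow> 'u list \<Rightarrow> nat \<Rightarrow> real" where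
  "node_degree f \<sigma> i = (\<Sum>j<length \<sigma>. weight f \<sigma> i j)"

definition degree_moment :: "real \<Rightarrow> ('u \<Rightarrow> 'u \<Rightarrow> real) \<Rightarrow> 'u list \<Rightarrow> real" where
  "degree_moment p f \<sigma> = (\<Sum>i<length \<sigma>. node_degree f \<sigma> i powr p)"

text \<open>The random output with distribution \<open>D\<close> is a \<open>(1 + \<epsilon>, \<delta>)\<close>-approximation of \<open>X\<close>.\<close>

definition approximates :: "real \<Rightarrow> real \<Rightarrow> real pmf \<Rightarrow> real \<Rightarrow> bool" where
  "approximates \<epsilon> \<delta> D X \<longleftrightarrow>
     measure_pmf.prob D {x. (1 - \<epsilon>) * X \<le> x \<and> x \<le> (1 + \<epsilon>) * X} \<ge> 1 - \<delta>"


section \<open>Node-arrival streaming algorithms\<close>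

text \<open>
  The algorithm is a program, that is, a finite syntactic object, on a random access machine
  with two banks of words: \<open>nums\<close> holds numbers and \<open>items\<close> holds stream items, where \<open>None\<close> is
  an empty cell. Items are opaque: the type of programs does not mention the type of items, items
  can only be moved, and the similarity function can only be evaluated (instruction \<open>Query\<close>) on
  items that are stored in a cell or that are arriving.

  Initially every cell is 0 or empty, except for the inputs. Hence a cell that has never been
  written carries no information, and the memory occupied by a bank is taken to be the shortest
  initial segment of addresses containing all cells that have ever been written. Its length is
  recorded in \<open>nums_used\<close> and \<open>items_used\<close>, which programs cannot read and which never decrease.
\<close>

record 'u memory =
  nums :: "nat \<Rightarrow> real"
  items :: "nat \<Rightarrow> 'u option"
  nums_used :: nat
  items_used :: nat

definition write_num :: "nat \<Rightarrow> real \<Rightarrow> 'u memory \<Rightarrow> 'u memory" where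
  "write_num a v s = s\<lparr>nums := (nums s)(a := v), nums_used := max (nums_used s) (Suc a)\<rparr>"

definition write_item :: "nat \<Rightarrow> 'u option \<Rightarrow> 'u memory \<Rightarrow> 'u memory" where
  "write_item a v s = s\<lparr>items := (items s)(a := v), items_used := max (items_used s) (Suc a)\<rparr>"

text \<open>
  An address is either a constant or the integer part of the content of a number cell. Numbers
  used as addresses, repetition counts or ranges are truncated to natural numbers.
\<close>

datatype address = Direct nat | Indirect nat

fun resolve :: "'u memory \<Rightarrow> address \<Rightarrow> nat" where
  "resolve s (Direct k) = k"
| "resolve s (Indirect k) = nat \<lfloor>nums s k\<rfloor>"

definition read_num :: "'u memory \<Rightarrow> address \<Rightarrow> real" where
  "read_num s a = nums s (resolve s a)"

datatype item_source = Arriving | Stored address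

fun read_item :: "'u option \<Rightarrow> 'u memory \<Rightarrow> item_source \<Rightarrow> 'u option" where
  "read_item cur s Arriving = cur"
| "read_item cur s (Stored a) = items s (resolve s a)"

datatype arith = Add | Sub | Mul | Div | Pow

fun arith_sem :: "arith \<Rightarrow> real \<Rightarrow> real \<Rightarrow> real" where
  "arith_sem Add x y = x + y"
| "arith_sem Sub x y = x - y"
| "arith_sem Mul x y = x * y"
| "arith_sem Div x y = x / y"
| "arith_sem Pow x y = x powr y"

datatype command =
    Skip
  | Const address real
  | Arith arith address address address
  | Log address address
  | Random address address
  | Query address item_source item_source
  | Store address item_source
  | Seq command command
  | IfLess address address command command
  | Repeat address command

primrec iterate :: "nat \<Rightarrow> ('s \<Rightarrow> 's pmf) \<Rightarrow> 's \<Rightarrow> 's pmf" where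
  "iterate 0 k s = return_pmf s"
| "iterate (Suc m) k s = bind_pmf (k s) (iterate m k)"

text \<open>
  \<open>Random d a\<close> draws a fresh integer uniformly from \<open>{0..<m}\<close>, where \<open>m\<close> is the content of \<open>a\<close>.
  \<open>Repeat a c\<close> fixes the number of iterations on entry, so every program terminates.
  The argument \<open>cur\<close> is the arriving item, if any.
\<close>

primrec exec :: "('u \<Rightarrow> 'u \<Rightarrow> real) \<Rightarrow> 'u option \<Rightarrow> command \<Rightarrow> 'u memory \<Rightarrow> 'u memory pmf" where
  "exec f cur Skip = return_pmf"
| "exec f cur (Const d r) = (\<lambda>s. return_pmf (write_num (resolve s d) r s))"
| "exec f cur (Arith op d a b) =
     (\<lambda>s. return_pmf (write_num (resolve s d) (arith_sem op (read_num s a) (read_num s b)) s))"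
| "exec f cur (Log d a) = (\<lambda>s. return_pmf (write_num (resolve s d) (ln (read_num s a)) s))"
| "exec f cur (Random d a) = (\<lambda>s.
     let m = nat \<lfloor>read_num s a\<rfloor> in
     if m = 0 then return_pmf (write_num (resolve s d) 0 s)
     else map_pmf (\<lambda>k. write_num (resolve s d) (real k) s) (pmf_of_set {..<m}))"
| "exec f cur (Query d x y) = (\<lambda>s. return_pmf (write_num (resolve s d)
     (case (read_item cur s x, read_item cur s y) of
        (Some u, Some v) \<Rightarrow> f u v
      | _ \<Rightarrow> 0) s))"
| "exec f cur (Store d x) = (\<lambda>s. return_pmf (write_item (resolve s d) (read_item cur s x) s))"
| "exec f cur (Seq c1 c2) = (\<lambda>s. bind_pmf (exec f cur c1 s) (exec f cur c2))"
| "exec f cur (IfLess a b c1 c2) =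
     (\<lambda>s. if read_num s a < read_num s b then exec f cur c1 s else exec f cur c2 s)"
| "exec f cur (Repeat a c) = (\<lambda>s. iterate (nat \<lfloor>read_num s a\<rfloor>) (exec f cur c) s)"

text \<open>
  A pass \<open>(c, c')\<close> executes \<open>c\<close> once for each arriving item, in stream order, and then \<open>c'\<close> once
  with no item arriving.
\<close>

record algorithm =
  prepare :: command
  passes :: "(command \<times> command) list"

primrec scan :: "('u \<Rightarrow> 'u \<Rightarrow> real) \<Rightarrow> command \<Rightarrow> 'u list \<Rightarrow> 'u memory \<Rightarrow> 'u memory pmf" where
  "scan f c [] s = return_pmf s"
| "scan f c (x # xs) s = bind_pmf (exec f (Some x) c s) (scan f c xs)"

primrec run_passes ::
  "('u \<Rightarrow> 'u \<Rightarrow> real) \<Rightarrow> 'u list \<Rightarrow> (command \<times> command) list \<Rightarrow> 'u memory \<Rightarrow> 'u memory pmf" where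
  "run_passes f \<sigma> [] s = return_pmf s"
| "run_passes f \<sigma> (P # Ps) s =
     bind_pmf (scan f (fst P) \<sigma> s) (\<lambda>s'.
     bind_pmf (exec f None (snd P) s') (run_passes f \<sigma> Ps))"

text \<open>The inputs \<open>n\<close> and \<open>\<epsilon>\<close> are in number cells 0 and 1; the output is read from cell 0.\<close>

definition initial :: "nat \<Rightarrow> real \<Rightarrow> 'u memory" where
  "initial n \<epsilon> = \<lparr>nums = (\<lambda>_. 0)(0 := real n, 1 := \<epsilon>), items = (\<lambda>_. None),
                  nums_used = 2, items_used = 0\<rparr>"

definition run :: "algorithm \<Rightarrow> ('u \<Rightarrow> 'u \<Rightarrow> real) \<Rightarrow> real \<Rightarrow> 'u list \<Rightarrow> 'u memory pmf" where
  "run A f \<epsilon> \<sigma> =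
     bind_pmf (exec f None (prepare A) (initial (length \<sigma>) \<epsilon>)) (run_passes f \<sigma> (passes A))"

definition result :: "'u memory \<Rightarrow> real" where
  "result s = nums s 0"

text \<open>
  Besides the two banks, the arriving item takes one word, and each of the nested \<open>Repeat\<close>
  commands being executed takes one word for the number of remaining iterations.
\<close>

primrec nesting :: "command \<Rightarrow> nat" where
  "nesting Skip = 0"
| "nesting (Const d r) = 0"
| "nesting (Arith op d a b) = 0"
| "nesting (Log d a) = 0"
| "nesting (Random d a) = 0"
| "nesting (Query d x y) = 0"
| "nesting (Store d x) = 0"
| "nesting (Seq c1 c2) = max (nesting c1) (nesting c2)"
| "nesting (IfLess a b c1 c2) = max (nesting c1) (nesting c2)"
| "nesting (Repeat a c) = Suc (nesting c)"

definition counters :: "algorithm \<Rightarrow> nat" where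
  "counters A =
     Max (insert (nesting (prepare A)) (\<Union>P\<in>set (passes A). {nesting (fst P), nesting (snd P)}))"

text \<open>The space of a run with final memory \<open>s\<close>, in words.\<close>

definition words_used :: "algorithm \<Rightarrow> 'u memory \<Rightarrow> nat" where
  "words_used A s = nums_used s + items_used s + counters A + 1"

end

theory Submission
  imports Defs
begin

text \<open>
  Let \<open>T = n powr (1 / (p + 1))\<close>, so that \<open>T powr p = n / T\<close>, and split
  \<open>d powr p = max (d powr p - T powr p) 0 + min (d powr p) (T powr p)\<close>. Draw about
  \<open>T powr p * ln n / \<epsilon>\<^sup>2\<close> positions uniformly with replacement and store their items in the first pass.
  In the second pass the similarities of an arriving item to the sample estimate its degree \<open>d\<close> up to
  \<open>\<eta> * max d T\<close>, for all items simultaneously by a Chernoff bound. The first summand vanishes below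
  \<open>T\<close>, so evaluating it at the estimates costs a relative error \<open>O(\<eta>)\<close>. The second summand lies
  between 1 and \<open>T powr p\<close>, so its average over the same sample, whose degrees become known exactly,
  concentrates by the same bound. Both parts are continuous in \<open>d\<close>, hence no node has to be
  classified as heavy or light and no independence between the two parts is needed.
\<close>

section \<open>Chernoff bounds\<close>

text \<open>For negative \<open>x\<close> put \<open>y = - x\<close>: the product of
  \<open>1 - y + y\<^sup>2\<close> with the quadratic Taylor lower bound of \<open>exp y\<close> is
  1 plus nonnegative terms.\<close>

lemma exp_le_quadratic:
  fixes x :: real
  assumes "\<bar>x\<bar> \<le> 1"
  shows "exp x \<le> 1 + x + x\<^sup>2"
proof (cases "0 \<le> x")
  case True
  then show ?thesis using exp_bound assms by simp
next
  case False
  define y where "y = - x"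
  have y: "0 \<le> y" using False y_def by simp
  have "1 \<le> 1 + y ^ 2 / 2 + y ^ 3 / 2 + y ^ 4 / 2" using y by simp
  also have "\<dots> = (1 - y + y\<^sup>2) * (1 + y + y\<^sup>2 / 2)"
    by (simp add: field_simps power2_eq_square power3_eq_cube power4_eq_xxxx)
  also have "\<dots> \<le> (1 - y + y\<^sup>2) * exp y"
  proof (rule mult_left_mono)
    show "0 \<le> 1 - y + y\<^sup>2" using assms y by (simp add: y_def)
  qed (use y exp_lower_Taylor_quadratic in simp)
  finally have "exp (- y) \<le> 1 - y + y\<^sup>2"
    by (simp add: exp_minus divide_simps)
  then show ?thesis by (simp add: y_def)
qed

text \<open>Independence of the draws makes the exponential moment multiplicative. The nonnegative
  integral avoids integrability conditions.\<close>

lemma nn_integral_exp_replicate_pmf: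
  fixes X :: "'a \<Rightarrow> real"
  shows "(\<integral>\<^sup>+xs. ennreal (exp (\<Sum>x\<leftarrow>xs. X x)) \<partial>replicate_pmf m D)
    = (\<integral>\<^sup>+x. ennreal (exp (X x)) \<partial>D) ^ m"
proof (induction m)
  case (Suc m)
  then show ?case
    by (simp add: nn_integral_bind_pmf exp_add ennreal_mult nn_integral_cmult nn_integral_multc)
qed simp

text \<open>Markov's inequality for the exponential of \<open>l\<close> times the sample sum; a
  positive \<open>l\<close> gives the upper tail, a negative one the lower tail. Values in
  \<open>{0..1}\<close> dominate their squares, so the second-order term involves only the mean.
  Hence a sample size of order \<open>1 / mu\<close> rather than \<open>1 / mu\<^sup>2\<close> will
  suffice.\<close>

lemma chernoff_one_sided:
  fixes X :: "nat \<Rightarrow> real"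
  assumes n: "n \<ge> 1" and X: "\<And>i. i < n \<Longrightarrow> X i \<in> {0..1}" and l: "\<bar>l\<bar> \<le> 1"
    and mu: "mu = (\<Sum>i<n. X i) / n"
  shows "measure_pmf.prob (replicate_pmf m (pmf_of_set {..<n}))
      {xs. a < l * ((\<Sum>x\<leftarrow>xs. X x) - real m * mu)} \<le> exp (m * (l\<^sup>2 * mu) - a)"
proof -
  let ?D = "pmf_of_set {..<n}"
  have ne: "{..<n} \<noteq> {}" using n by (auto simp: lessThan_empty_iff)
  have "(\<Sum>i<n. exp (l * X i)) \<le> (\<Sum>i<n. 1 + (l + l\<^sup>2) * X i)"
  proof (rule sum_mono)
    fix i assume "i \<in> {..<n}"
    then have x: "X i \<in> {0..1}" using X by simp
    have "\<bar>l * X i\<bar> \<le> 1" using l x by (simp add: abs_mult mult_le_one)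
    then have "exp (l * X i) \<le> 1 + l * X i + (l * X i)\<^sup>2" by (rule exp_le_quadratic)
    also have "1 + l * X i + (l * X i)\<^sup>2 \<le> 1 + l * X i + l\<^sup>2 * X i"
    proof -
      have "(X i)\<^sup>2 \<le> X i"
        using x by (simp add: power2_eq_square mult_left_le)
      then show ?thesis by (simp add: power_mult_distrib mult_left_mono)
    qed
    finally show "exp (l * X i) \<le> 1 + (l + l\<^sup>2) * X i" by (simp add: algebra_simps)
  qed
  also have "\<dots> = n + (l + l\<^sup>2) * (\<Sum>i<n. X i)"
    by (simp add: sum.distrib sum_distrib_left)
  also have "\<dots> = n * (1 + (l + l\<^sup>2) * mu)"
    using n by (simp add: mu distrib_left)
  also have "\<dots> \<le> n * exp ((l + l\<^sup>2) * mu)"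
    by (intro mult_left_mono exp_ge_add_one_self) auto
  finally have sum_le: "(\<Sum>i<n. exp (l * X i)) \<le> n * exp ((l + l\<^sup>2) * mu)" .
  have "(\<integral>\<^sup>+x. ennreal (exp (l * X x)) \<partial>measure_pmf ?D) = ennreal ((\<Sum>i<n. exp (l * X i)) / n)"
    using ne n by (simp add: nn_integral_pmf_of_set sum_ennreal divide_ennreal sum_nonneg ennreal_of_nat_eq_real_of_nat)
  also have "\<dots> \<le> ennreal (exp ((l + l\<^sup>2) * mu))"
    using sum_le n by (intro ennreal_leI) (simp add: field_simps)
  finally have single: "(\<integral>\<^sup>+x. ennreal (exp (l * X x)) \<partial>measure_pmf ?D) \<le> ennreal (exp ((l + l\<^sup>2) * mu))" .
  \<comment> \<open>On the event in question \<open>l\<close> times the sum exceeds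
    \<open>b\<close>, so \<open>exp (- b)\<close> times its exponential dominates the
    indicator.\<close>
  define b where "b = a + l * (real m * mu)"
  have "emeasure (measure_pmf (replicate_pmf m ?D)) {xs. a < l * ((\<Sum>x\<leftarrow>xs. X x) - real m * mu)}
      = (\<integral>\<^sup>+xs. indicator {xs. a < l * ((\<Sum>x\<leftarrow>xs. X x) - real m * mu)} xs \<partial>measure_pmf (replicate_pmf m ?D))"
    by simp
  also have "\<dots> \<le> (\<integral>\<^sup>+xs. ennreal (exp (- b)) * ennreal (exp (\<Sum>x\<leftarrow>xs. l * X x)) \<partial>measure_pmf (replicate_pmf m ?D))"
  proof (rule nn_integral_mono)
    fix xs
    show "indicator {xs. a < l * ((\<Sum>x\<leftarrow>xs. X x) - real m * mu)} xs
        \<le> ennreal (exp (- b)) * ennreal (exp (\<Sum>x\<leftarrow>xs. l * X x))"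
      by (auto simp: indicator_def b_def sum_list_const_mult algebra_simps
          ennreal_mult[symmetric] exp_add[symmetric])
  qed
  also have "\<dots> = ennreal (exp (- b)) * (\<integral>\<^sup>+x. ennreal (exp (l * X x)) \<partial>measure_pmf ?D) ^ m"
    by (simp add: nn_integral_cmult nn_integral_exp_replicate_pmf)
  also have "\<dots> \<le> ennreal (exp (- b)) * ennreal (exp ((l + l\<^sup>2) * mu)) ^ m"
    by (intro mult_left_mono power_mono single) auto
  also have "\<dots> = ennreal (exp (m * (l\<^sup>2 * mu) - a))"
    by (simp add: ennreal_power ennreal_mult[symmetric] exp_of_nat_mult[symmetric]
        exp_add[symmetric] b_def algebra_simps)
  finally show ?thesis
    by (simp add: measure_pmf.emeasure_eq_measure)
qed

text \<open>The deviation is measured against an upper bound \<open>b\<close> of the mean, because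
  for a low degree the permitted error is governed by the threshold and not by the degree
  itself.\<close>

lemma chernoff_two_sided:
  fixes X :: "nat \<Rightarrow> real"
  assumes n: "n \<ge> 1" and X: "\<And>i. i < n \<Longrightarrow> X i \<in> {0..1}" and h: "0 < h" "h \<le> 1"
    and mu: "mu = (\<Sum>i<n. X i) / n" and b: "mu \<le> b"
  shows "measure_pmf.prob (replicate_pmf m (pmf_of_set {..<n}))
      {xs. m * (h * b) < \<bar>(\<Sum>x\<leftarrow>xs. X x) - m * mu\<bar>} \<le> 2 * exp (- (m * (h\<^sup>2 * b) / 4))"
proof -
  let ?R = "replicate_pmf m (pmf_of_set {..<n})"
  \<comment> \<open>The permitted deviation times \<open>h / 2\<close>. Taking \<open>h / 2\<close>
    for \<open>l\<close> minimises the exponent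
    \<open>m * (l\<^sup>2 * b - l * h * b)\<close>.\<close>
  define a where "a = h / 2 * (m * (h * b))"
  define E where "E l = {xs. a < l * ((\<Sum>x\<leftarrow>xs. X x) - m * mu)}" for l
  have E: "measure_pmf.prob ?R (E l) \<le> exp (- (m * (h\<^sup>2 * b) / 4))" if l: "\<bar>l\<bar> = h / 2" for l
  proof -
    have l2: "l\<^sup>2 = h\<^sup>2 / 4" unfolding power2_abs[of l, symmetric] l by (simp add: power_divide)
    have "m * (l\<^sup>2 * mu) \<le> m * (l\<^sup>2 * b)"
      using b by (intro mult_left_mono) auto
    also have "\<dots> = m * (h\<^sup>2 * b) / 4" by (simp add: l2)
    finally have "m * (l\<^sup>2 * mu) \<le> m * (h\<^sup>2 * b) / 4" .
    moreover have "a = m * (h\<^sup>2 * b) / 2"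
      by (simp add: a_def power2_eq_square)
    ultimately have "m * (l\<^sup>2 * mu) - a \<le> - (m * (h\<^sup>2 * b) / 4)"
      by simp
    moreover have "measure_pmf.prob ?R (E l) \<le> exp (m * (l\<^sup>2 * mu) - a)"
      unfolding E_def by (rule chernoff_one_sided[OF n X _ mu]) (use l h in auto)
    ultimately show ?thesis by (meson exp_le_cancel_iff order_trans)
  qed
  have "{xs. m * (h * b) < \<bar>(\<Sum>x\<leftarrow>xs. X x) - m * mu\<bar>} \<subseteq> E (h / 2) \<union> E (- (h / 2))"
  proof
    fix xs assume "xs \<in> {xs. m * (h * b) < \<bar>(\<Sum>x\<leftarrow>xs. X x) - m * mu\<bar>}"
    then have "m * (h * b) < \<bar>(\<Sum>x\<leftarrow>xs. X x) - m * mu\<bar>" by simp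
    then have "a < h / 2 * \<bar>(\<Sum>x\<leftarrow>xs. X x) - m * mu\<bar>"
      unfolding a_def using h by (intro mult_strict_left_mono) auto
    then show "xs \<in> E (h / 2) \<union> E (- (h / 2))"
      unfolding E_def by (cases "(\<Sum>x\<leftarrow>xs. X x) < m * mu") (auto simp: algebra_simps)
  qed
  then have "measure_pmf.prob ?R {xs. m * (h * b) < \<bar>(\<Sum>x\<leftarrow>xs. X x) - m * mu\<bar>}
      \<le> measure_pmf.prob ?R (E (h / 2) \<union> E (- (h / 2)))"
    by (intro measure_pmf.finite_measure_mono) auto
  also have "\<dots> \<le> measure_pmf.prob ?R (E (h / 2)) + measure_pmf.prob ?R (E (- (h / 2)))"
    by (intro measure_Un_le) auto
  also have "\<dots> \<le> 2 * exp (- (m * (h\<^sup>2 * b) / 4))"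
    using E[of "h / 2"] E[of "- (h / 2)"] h by simp
  finally show ?thesis .
qed


section \<open>The estimator\<close>

text \<open>Dividing by \<open>v\<close> moves the claim to \<open>r = u / v\<close> near 1, where
  the mean value theorem applies. On \<open>{1/2..3/2}\<close> the logarithm is at most
  \<open>ln 2\<close> in absolute value, which bounds \<open>x powr (p - 1)\<close> for either sign
  of \<open>p - 1\<close> and yields \<open>L\<close>.\<close>

lemma powr_relative_error:
  fixes p :: real
  assumes p: "p > 0"
  defines "L \<equiv> p * 2 powr \<bar>p - 1\<bar>"
  assumes v: "v > 0" and h: "h \<le> 1 / 2" and uv: "\<bar>u - v\<bar> \<le> h * v"
  shows "\<bar>u powr p - v powr p\<bar> \<le> L * h * v powr p"
proof -
  define r where "r = u / v"
  have "\<bar>r - 1\<bar> = \<bar>u - v\<bar> / v" using v by (simp add: r_def field_simps abs_divide)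
  then have r: "\<bar>r - 1\<bar> \<le> h" using uv v by (simp add: pos_divide_le_eq)
  have "norm (r powr p - 1 powr p) \<le> L * norm (r - 1)"
  proof (rule field_differentiable_bound[where S = "{1/2..3/2}" and f' = "\<lambda>x. p * x powr (p - 1)"])
    fix x :: real assume x: "x \<in> {1/2..3/2}"
    then show "((\<lambda>x. x powr p) has_field_derivative p * x powr (p - 1)) (at x within {1/2..3/2})"
      by (auto intro!: derivative_eq_intros)
    have "\<bar>ln x\<bar> \<le> ln 2"
    proof -
      have "ln x \<le> ln 2" using x by simp
      moreover have "ln (1 / 2) \<le> ln x" using x by (subst ln_le_cancel_iff) auto
      then have "- ln 2 \<le> ln x" by (simp add: ln_div)
      ultimately show ?thesis by simp
    qed
    then have "\<bar>(p - 1) * ln x\<bar> \<le> \<bar>p - 1\<bar> * ln 2"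
      by (simp add: abs_mult mult_left_mono)
    then have "x powr (p - 1) \<le> 2 powr \<bar>p - 1\<bar>"
      using x by (simp add: powr_def)
    then show "norm (p * x powr (p - 1)) \<le> L"
      using p by (simp add: L_def abs_mult)
  qed (use r h in auto)
  also have "\<dots> \<le> L * h"
    using r p by (intro mult_left_mono) (auto simp: L_def)
  finally have "\<bar>r powr p - 1\<bar> \<le> L * h" by simp
  then have "\<bar>r powr p - 1\<bar> * v powr p \<le> L * h * v powr p"
    by (intro mult_right_mono) auto
  moreover have "(r powr p - 1) * v powr p = u powr p - v powr p"
    using v by (simp add: left_diff_distrib r_def flip: powr_mult)
  then have "\<bar>r powr p - 1\<bar> * v powr p = \<bar>u powr p - v powr p\<bar>"
    by (metis abs_mult abs_of_nonneg powr_ge_zero)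
  ultimately show ?thesis by simp
qed

text \<open>The first summand of the splitting, in the conditional form in which the program
  evaluates it by a comparison with the threshold.\<close>

definition excess :: "real \<Rightarrow> real \<Rightarrow> real \<Rightarrow> real" where
  "excess p T x = (if T < x then x powr p - T powr p else 0)"

text \<open>This form turns a difference of excesses into a difference of powers at arguments
  clamped to at least \<open>T\<close>; clamping does not enlarge the distance of the
  arguments.\<close>

lemma excess_max: "T > 0 \<Longrightarrow> p > 0 \<Longrightarrow> excess p T x = max x T powr p - T powr p"
  by (auto simp: excess_def max_def)

lemma excess_plus_min:
  assumes "p > 0" "T > 0" "x > 0"
  shows "excess p T x + min (x powr p) (T powr p) = x powr p"
proof (cases "T < x")
  case True
  then have "T powr p \<le> x powr p" using assms by (intro powr_mono2) auto
  then show ?thesis using True by (simp add: excess_def)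
next
  case False
  then have "x powr p \<le> T powr p" using assms by (intro powr_mono2) auto
  then show ?thesis using False by (simp add: excess_def)
qed

text \<open>An error of \<open>h * max d T\<close> is a relative error \<open>h\<close> at the
  clamped degree. The bound in terms of \<open>d\<close> itself holds because both excesses vanish
  unless \<open>d\<close> is at least half of \<open>T\<close>.\<close>

lemma excess_error:
  fixes p :: real
  assumes p: "p > 0" and T: "T > 0" and d: "d > 0" and h: "0 \<le> h" "h \<le> 1 / 2"
    and e: "\<bar>e - d\<bar> \<le> h * max d T"
  shows "\<bar>excess p T e - excess p T d\<bar> \<le> p * 2 powr \<bar>p - 1\<bar> * 2 powr p * h * d powr p"
proof (cases "T < e \<or> T \<le> d")
  case False
  then show ?thesis using p h by (simp add: excess_def)
next
  case True
  let ?L = "p * 2 powr \<bar>p - 1\<bar>"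
  have "h * max d T \<le> max d T / 2" using h T mult_right_mono[of h "1/2" "max d T"] by simp
  \<comment> \<open>If \<open>d < T < e\<close>, then \<open>T - d\<close> is below the permitted
    error, which is at most \<open>T / 2\<close>. The factor 2 costs \<open>2 powr p\<close>
    below.\<close>
  then have le: "max d T \<le> 2 * d" using True e by (auto simp: max_def split: if_splits)
  have "\<bar>excess p T e - excess p T d\<bar> = \<bar>max e T powr p - max d T powr p\<bar>"
    using T p by (simp add: excess_max)
  also have "\<dots> \<le> ?L * h * max d T powr p"
    using T h e by (intro powr_relative_error[OF p]) auto
  also have "\<dots> \<le> ?L * h * (2 * d) powr p"
    using le T p h by (intro mult_left_mono powr_mono2) auto
  also have "(2 * d) powr p = 2 powr p * d powr p"
    by (rule powr_mult)
  finally show ?thesis by (simp add: mult_ac)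
qed

section \<open>Degrees, the threshold and the two-part estimate\<close>

lemma weight_bounds:
  assumes "similarity U f" "set \<sigma> \<subseteq> U" "i < length \<sigma>" "j < length \<sigma>"
  shows "weight f \<sigma> i j \<in> {0..1}"
  using assms nth_mem[of i \<sigma>] nth_mem[of j \<sigma>] unfolding similarity_def weight_def by blast

lemma weight_commute:
  assumes "similarity U f" "set \<sigma> \<subseteq> U" "i < length \<sigma>" "j < length \<sigma>"
  shows "weight f \<sigma> i j = weight f \<sigma> j i"
  using assms nth_mem[of i \<sigma>] nth_mem[of j \<sigma>] unfolding similarity_def weight_def by blast

text \<open>The self-loop contributes 1. This keeps the capped powers at least 1 and so bounds their
  mean from below.\<close>

lemma node_degree_ge_1:
  assumes "similarity U f" "set \<sigma> \<subseteq> U" "i < length \<sigma>"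
  shows "1 \<le> node_degree f \<sigma> i"
proof -
  have "weight f \<sigma> i i = 1"
    using assms nth_mem[of i \<sigma>] unfolding similarity_def weight_def by blast
  moreover have "weight f \<sigma> i i \<le> node_degree f \<sigma> i"
    unfolding node_degree_def
    using assms weight_bounds[OF assms(1,2,3)] by (intro member_le_sum) auto
  ultimately show ?thesis by simp
qed

text \<open>This choice balances two sample sizes: \<open>n / T\<close> for estimating degrees up to
  the threshold, and \<open>T powr p\<close> for averaging values between 1 and
  \<open>T powr p\<close>.\<close>

definition threshold :: "real \<Rightarrow> nat \<Rightarrow> real" where
  "threshold p n = n powr (1 / (p + 1))"

lemma threshold_powr:
  assumes "p > 0"
  shows "threshold p n powr p = n powr (1 - 1 / (p + 1))"
  using assms by (simp add: threshold_def powr_powr field_simps)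

lemma threshold_mult_powr:
  assumes "p > 0"
  shows "threshold p n * threshold p n powr p = n"
  unfolding threshold_powr[OF assms] unfolding threshold_def by (simp flip: powr_add)

lemma threshold_ge_1:
  assumes "p > 0" "n \<ge> 1"
  shows "1 \<le> threshold p n" "1 \<le> threshold p n powr p"
  using assms by (auto simp: threshold_def ge_one_powr_ge_zero)

definition degree_estimate ::
  "('u \<Rightarrow> 'u \<Rightarrow> real) \<Rightarrow> 'u list \<Rightarrow> nat list \<Rightarrow> nat \<Rightarrow> real" where
  "degree_estimate f \<sigma> xs j = (\<Sum>x\<leftarrow>xs. weight f \<sigma> j x) * length \<sigma> / length xs"

definition capped :: "real \<Rightarrow> ('u \<Rightarrow> 'u \<Rightarrow> real) \<Rightarrow> 'u list \<Rightarrow> nat \<Rightarrow> real" where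
  "capped p f \<sigma> i =
     min (node_degree f \<sigma> i powr p) (threshold p (length \<sigma>) powr p)"

definition moment_estimate ::
  "real \<Rightarrow> ('u \<Rightarrow> 'u \<Rightarrow> real) \<Rightarrow> 'u list \<Rightarrow> nat list \<Rightarrow> real" where
  "moment_estimate p f \<sigma> xs =
     (\<Sum>j<length \<sigma>. excess p (threshold p (length \<sigma>)) (degree_estimate f \<sigma> xs j)) +
     (\<Sum>x\<leftarrow>xs. capped p f \<sigma> x) * length \<sigma> / length xs"

text \<open>The first summand is the constant of \<open>excess_error\<close>. Of the remaining 2,
  one unit pays for the capped part; with both, \<open>\<epsilon> / error_factor p\<close> is at
  most \<open>1 / 2\<close>.\<close>

definition error_factor :: "real \<Rightarrow> real" where
  "error_factor p = p * 2 powr \<bar>p - 1\<bar> * 2 powr p + 2"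

lemma error_factor_ge_2: "p > 0 \<Longrightarrow> error_factor p \<ge> 2"
  by (simp add: error_factor_def)

text \<open>The deterministic half of the analysis: the error is the sum of \<open>H\<close>,
  bounded node by node through \<open>excess_error\<close>, and \<open>C\<close>, where the capped
  sum is at most the full moment.\<close>

lemma moment_estimate_error:
  assumes p: "p > 0" and sim: "similarity U f" "set \<sigma> \<subseteq> U" and n: "n = length \<sigma>" "n \<ge> 1"
    and h: "0 \<le> h" "h \<le> 1 / 2"
    and heavy: "\<And>j. j < n \<Longrightarrow> \<bar>degree_estimate f \<sigma> xs j - node_degree f \<sigma> j\<bar>
      \<le> h * max (node_degree f \<sigma> j) (threshold p n)"
    and light: "\<bar>(\<Sum>x\<leftarrow>xs. capped p f \<sigma> x) * n / length xs - (\<Sum>i<n. capped p f \<sigma> i)\<bar>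
      \<le> h * (\<Sum>i<n. capped p f \<sigma> i)"
  shows "\<bar>moment_estimate p f \<sigma> xs - degree_moment p f \<sigma>\<bar> \<le> error_factor p * h * degree_moment p f \<sigma>"
proof -
  let ?d = "node_degree f \<sigma>" and ?T = "threshold p n"
  let ?e = "degree_estimate f \<sigma> xs"
  define L where "L = p * 2 powr \<bar>p - 1\<bar> * 2 powr p"
  define H where "H = (\<Sum>j<n. excess p ?T (?e j)) - (\<Sum>j<n. excess p ?T (?d j))"
  define C where "C = (\<Sum>x\<leftarrow>xs. capped p f \<sigma> x) * n / length xs - (\<Sum>i<n. capped p f \<sigma> i)"
  have T: "?T > 0" using threshold_ge_1[OF p n(2)] by simp
  have d: "?d j \<ge> 1" if "j < n" for j using node_degree_ge_1[OF sim] that n by simp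
  have M: "degree_moment p f \<sigma> = (\<Sum>j<n. ?d j powr p)"
    by (simp add: degree_moment_def n)
  have "excess p ?T (?d j) + capped p f \<sigma> j = ?d j powr p" if "j < n" for j
    unfolding capped_def n(1)[symmetric] using d[OF that] p T by (intro excess_plus_min) auto
  then have split: "degree_moment p f \<sigma> = (\<Sum>j<n. excess p ?T (?d j)) + (\<Sum>i<n. capped p f \<sigma> i)"
    unfolding M by (simp flip: sum.distrib)
  have "\<bar>H\<bar> \<le> (\<Sum>j<n. \<bar>excess p ?T (?e j) - excess p ?T (?d j)\<bar>)"
    unfolding H_def sum_subtractf[symmetric] by (rule sum_abs)
  also have "\<dots> \<le> (\<Sum>j<n. L * h * ?d j powr p)"
  proof (rule sum_mono)
    fix j assume "j \<in> {..<n}"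
    then have j: "j < n" by simp
    then show "\<bar>excess p ?T (?e j) - excess p ?T (?d j)\<bar> \<le> L * h * ?d j powr p"
      unfolding L_def using d[OF j] by (intro excess_error p T h heavy) auto
  qed
  also have "\<dots> = L * h * degree_moment p f \<sigma>" by (simp add: M sum_distrib_left)
  finally have H: "\<bar>H\<bar> \<le> L * h * degree_moment p f \<sigma>" .
  have "(\<Sum>i<n. capped p f \<sigma> i) \<le> degree_moment p f \<sigma>"
    unfolding M by (intro sum_mono) (simp add: capped_def)
  then have C: "\<bar>C\<bar> \<le> h * degree_moment p f \<sigma>"
    using light h unfolding C_def by (meson mult_left_mono order_trans)
  have "degree_moment p f \<sigma> \<ge> 0" unfolding M by (simp add: sum_nonneg)
  then have "h * degree_moment p f \<sigma> \<ge> 0" using h by simp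
  moreover have "moment_estimate p f \<sigma> xs - degree_moment p f \<sigma> = H + C"
    unfolding split moment_estimate_def H_def C_def n by simp
  moreover have "\<bar>H + C\<bar> \<le> (L * h + h) * degree_moment p f \<sigma>"
    using H C by (simp add: distrib_right)
  ultimately show ?thesis
    by (simp add: error_factor_def L_def algebra_simps)
qed

text \<open>A union bound over \<open>n\<close> events for the degrees and one for the capped
  average. All concern the same sample, and the union bound needs no independence between
  them.\<close>

lemma moment_estimate_concentration:
  assumes p: "p > 0" and sim: "similarity U f" "set \<sigma> \<subseteq> U" and n: "n = length \<sigma>" "n \<ge> 1"
    and h: "0 < h" "h \<le> 1 / 2"
    and m: "4 * threshold p n powr p * ln (400 * n) / h\<^sup>2 \<le> real m"
  shows "measure_pmf.prob (replicate_pmf m (pmf_of_set {..<n}))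
     {xs. \<bar>moment_estimate p f \<sigma> xs - degree_moment p f \<sigma>\<bar>
        \<le> error_factor p * h * degree_moment p f \<sigma>} \<ge> 0.99"
    (is "measure_pmf.prob ?R ?good \<ge> _")
proof -
  let ?d = "node_degree f \<sigma>" and ?T = "threshold p n"
  define K where "K = threshold p n powr p"
  have K: "K \<ge> 1" and T: "?T \<ge> 1" using threshold_ge_1[OF p n(2)] by (auto simp: K_def)
  \<comment> \<open>The balance \<open>T * T powr p = n\<close> makes \<open>1 / K\<close> a common
    lower bound for the scales \<open>b j\<close> and for the mean \<open>\<mu>\<close>.\<close>
  have TK: "?T / n = 1 / K"
    using threshold_mult_powr[OF p, of n] n(2) T K by (simp add: K_def[symmetric] field_simps)
  have d: "?d j \<ge> 1" if "j < n" for j using node_degree_ge_1[OF sim] that n by simp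
  have n0: "real n > 0" using n(2) by simp
  have "0 < ln (400 * real n)" using n by (intro ln_gt_zero) auto
  then have "0 < 4 * K * ln (400 * n) / h\<^sup>2" using K h by simp
  then have m0: "m > 0" using m by (simp add: K_def)
  \<comment> \<open>One estimate serves all events; the 400 in the logarithm becomes 200 through the
    factor 2 of the two tails.\<close>
  have tail: "2 * exp (- (m * (h\<^sup>2 * b) / 4)) \<le> 1 / (200 * n)" if b: "1 / K \<le> b" for b
  proof -
    have "4 * K * ln (400 * n) / h\<^sup>2 * (h\<^sup>2 * (1 / K)) \<le> m * (h\<^sup>2 * b)"
      using m b h K by (intro mult_mono) (auto simp: K_def)
    then have "ln (400 * n) \<le> m * (h\<^sup>2 * b) / 4" using h K by (simp add: field_simps)
    then have "exp (- (m * (h\<^sup>2 * b) / 4)) \<le> exp (- ln (400 * n))" by simp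
    also have "\<dots> = 1 / (400 * n)" using n0 by (simp add: exp_minus field_simps)
    finally show ?thesis by simp
  qed
  define w where "w j = (\<lambda>x. weight f \<sigma> j x)" for j
  define b where "b j = max (?d j) ?T / n" for j
  define heavy where "heavy j =
    {xs. m * (h * b j) < \<bar>(\<Sum>x\<leftarrow>xs. w j x) - m * (?d j / n)\<bar>}" for j
  \<comment> \<open>Dividing by \<open>K\<close> puts the capped powers into
    \<open>{1/K..1}\<close>, as the Chernoff bound requires.\<close>
  define c where "c i = capped p f \<sigma> i / K" for i
  define \<mu> where "\<mu> = (\<Sum>i<n. c i) / n"
  define light where "light = {xs. m * (h * \<mu>) < \<bar>(\<Sum>x\<leftarrow>xs. c x) - m * \<mu>\<bar>}"
  have heavy: "measure_pmf.prob ?R (heavy j) \<le> 1 / (200 * n)" if j: "j < n" for j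
  proof -
    have "measure_pmf.prob ?R (heavy j) \<le> 2 * exp (- (m * (h\<^sup>2 * b j) / 4))"
      unfolding heavy_def
    proof (rule chernoff_two_sided[OF n(2)])
      show "w j i \<in> {0..1}" if "i < n" for i
        using weight_bounds[OF sim] that j n by (simp add: w_def)
      show "?d j / n = (\<Sum>i<n. w j i) / n" by (simp add: w_def node_degree_def n)
      show "?d j / n \<le> b j" by (simp add: b_def divide_right_mono)
    qed (use h in auto)
    also have "\<dots> \<le> 1 / (200 * n)"
      by (intro tail) (simp add: b_def TK[symmetric] divide_right_mono)
    finally show ?thesis .
  qed
  have c: "1 / K \<le> c i" "c i \<le> 1" if "i < n" for i
  proof -
    have "1 \<le> ?d i powr p" using d[OF that] p by (simp add: ge_one_powr_ge_zero)
    then have "1 \<le> capped p f \<sigma> i" using K by (simp add: capped_def K_def n)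
    then show "1 / K \<le> c i" using K by (simp add: c_def divide_right_mono)
    have "capped p f \<sigma> i \<le> K" by (simp add: capped_def K_def n)
    then show "c i \<le> 1" using K by (simp add: c_def)
  qed
  have "n * (1 / K) \<le> (\<Sum>i<n. c i)"
    using sum_bounded_below[of "{..<n}" "1 / K" c] c by simp
  then have \<mu>: "1 / K \<le> \<mu>" using n0 by (simp add: \<mu>_def pos_le_divide_eq mult.commute)
  have light: "measure_pmf.prob ?R light \<le> 1 / (200 * n)"
  proof -
    have "measure_pmf.prob ?R light \<le> 2 * exp (- (m * (h\<^sup>2 * \<mu>) / 4))"
      unfolding light_def
    proof (rule chernoff_two_sided[OF n(2)])
      show "c i \<in> {0..1}" if "i < n" for i
        using c[OF that] K by (auto intro: order_trans[of 0 "1 / K"])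
      show "\<mu> = (\<Sum>i<n. c i) / n" by (simp add: \<mu>_def)
    qed (use h in auto)
    also have "\<dots> \<le> 1 / (200 * n)" using \<mu> by (rule tail)
    finally show ?thesis .
  qed
  \<comment> \<open>The inclusion is restricted to the support because only there is
    \<open>length xs\<close>, by which the estimates divide, known to be \<open>m\<close>.\<close>
  have "set_pmf ?R \<subseteq> ?good \<union> ((\<Union>j<n. heavy j) \<union> light)"
  proof
    fix xs assume "xs \<in> set_pmf ?R"
    then have len: "length xs = m" by (auto simp: set_replicate_pmf)
    show "xs \<in> ?good \<union> ((\<Union>j<n. heavy j) \<union> light)"
    proof (cases "xs \<in> (\<Union>j<n. heavy j) \<union> light")
      case False
      have "xs \<in> ?good"
      proof (safe, rule moment_estimate_error[OF p sim n])
        fix j assume j: "j < n"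
        then have "\<bar>(\<Sum>x\<leftarrow>xs. w j x) - m * (?d j / n)\<bar> \<le> m * (h * b j)"
          using False by (auto simp: heavy_def not_less)
        \<comment> \<open>Multiplying by \<open>n / m\<close> rescales the sample sum to the degree
          estimate.\<close>
        then have "\<bar>(\<Sum>x\<leftarrow>xs. w j x) - m * (?d j / n)\<bar> * (n / m) \<le> m * (h * b j) * (n / m)"
          by (intro mult_right_mono) auto
        moreover have "m * (h * b j) * (n / m) = h * max (?d j) ?T"
          using m0 n0 by (simp add: b_def)
        moreover have "\<bar>(\<Sum>x\<leftarrow>xs. w j x) - m * (?d j / n)\<bar> * (n / m)
            = \<bar>((\<Sum>x\<leftarrow>xs. w j x) - m * (?d j / n)) * (n / m)\<bar>"
          by (simp add: abs_mult)
        moreover have "((\<Sum>x\<leftarrow>xs. w j x) - m * (?d j / n)) * (n / m)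
            = degree_estimate f \<sigma> xs j - ?d j"
          using m0 n0 unfolding degree_estimate_def len w_def n(1)[symmetric]
          by (simp add: left_diff_distrib diff_divide_distrib)
        ultimately show "\<bar>degree_estimate f \<sigma> xs j - ?d j\<bar> \<le> h * max (?d j) ?T"
          by (simp only:)
      next
        let ?s = "\<Sum>x\<leftarrow>xs. capped p f \<sigma> x" and ?t = "\<Sum>i<n. capped p f \<sigma> i"
        have s: "(\<Sum>x\<leftarrow>xs. c x) = ?s / K"
          by (induction xs) (auto simp: c_def add_divide_distrib)
        have t: "\<mu> = ?t / K / n" by (simp add: \<mu>_def c_def sum_divide_distrib)
        have "\<bar>(\<Sum>x\<leftarrow>xs. c x) - m * \<mu>\<bar> \<le> m * (h * \<mu>)"
          using False by (auto simp: light_def not_less)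
        then have "\<bar>(\<Sum>x\<leftarrow>xs. c x) - m * \<mu>\<bar> * (K * n / m) \<le> m * (h * \<mu>) * (K * n / m)"
          using K by (intro mult_right_mono) auto
        moreover have "m * (h * \<mu>) * (K * n / m) = h * ?t"
          using m0 n0 K by (simp add: t)
        moreover have "\<bar>(\<Sum>x\<leftarrow>xs. c x) - m * \<mu>\<bar> * (K * n / m)
            = \<bar>((\<Sum>x\<leftarrow>xs. c x) - m * \<mu>) * (K * n / m)\<bar>"
          using K by (simp add: abs_mult)
        moreover have "((\<Sum>x\<leftarrow>xs. c x) - m * \<mu>) * (K * n / m) = ?s * n / m - ?t"
          using m0 n0 K unfolding s t by (simp add: left_diff_distrib diff_divide_distrib)
        ultimately show "\<bar>?s * n / length xs - ?t\<bar> \<le> h * ?t"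
          by (simp only: len)
      qed (use h in auto)
      then show ?thesis by simp
    qed simp
  qed
  then have "measure_pmf.prob ?R (set_pmf ?R)
      \<le> measure_pmf.prob ?R (?good \<union> ((\<Union>j<n. heavy j) \<union> light))"
    by (intro measure_pmf.finite_measure_mono) auto
  also have "\<dots> \<le> measure_pmf.prob ?R ?good + measure_pmf.prob ?R ((\<Union>j<n. heavy j) \<union> light)"
    by (intro measure_Un_le) auto
  also have "measure_pmf.prob ?R ((\<Union>j<n. heavy j) \<union> light)
      \<le> measure_pmf.prob ?R (\<Union>j<n. heavy j) + measure_pmf.prob ?R light"
    by (intro measure_Un_le) auto
  also have "measure_pmf.prob ?R (\<Union>j<n. heavy j) \<le> (\<Sum>j<n. measure_pmf.prob ?R (heavy j))"
    by (intro measure_UNION_le) auto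
  also have "\<dots> \<le> (\<Sum>j<n. 1 / (200 * n))"
    using heavy by (intro sum_mono) auto
  also note light
  \<comment> \<open>The total is \<open>(n + 1) / (200 * n)\<close>, at most \<open>1 / 100\<close>
    as \<open>n\<close> is at least 1.\<close>
  also have "(\<Sum>j<n. 1 / (200 * n)) + 1 / (200 * n) \<le> 0.01"
    using n0 n(2) by (simp add: field_simps)
  also have "measure_pmf.prob ?R (set_pmf ?R) = 1"
    using emeasure_pmf[of ?R] by (simp add: measure_pmf.emeasure_eq_measure)
  finally show ?thesis by simp
qed


section \<open>The streaming program\<close>

lemma write_num_simps [simp]:
  "nums (write_num a v s) = (nums s)(a := v)"
  "items (write_num a v s) = items s"
  "nums_used (write_num a v s) = max (nums_used s) (Suc a)"
  "items_used (write_num a v s) = items_used s"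
  by (simp_all add: write_num_def)

lemma write_item_simps [simp]:
  "nums (write_item a v s) = nums s"
  "items (write_item a v s) = (items s)(a := v)"
  "nums_used (write_item a v s) = nums_used s"
  "items_used (write_item a v s) = max (items_used s) (Suc a)"
  by (simp_all add: write_item_def)

text \<open>The invariant is indexed by the number of completed rounds; since \<open>iterate\<close>
  peels off the first round, the induction shifts the index.\<close>

lemma iterate_invariant:
  assumes "s' \<in> set_pmf (iterate m k s)" "I 0 s"
    and "\<And>t s s'. t < m \<Longrightarrow> I t s \<Longrightarrow> s' \<in> set_pmf (k s) \<Longrightarrow> I (Suc t) s'"
  shows "I m s'"
  using assms
proof (induction m arbitrary: I s)
  case (Suc m)
  from Suc.prems(1) obtain s1 where s1: "s1 \<in> set_pmf (k s)" "s' \<in> set_pmf (iterate m k s1)"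
    by auto
  show ?case
    by (rule Suc.IH[of s1 "\<lambda>t. I (Suc t)"]) (use s1 Suc.prems(2,3) in auto)
qed simp

lemma scan_invariant:
  assumes "s' \<in> set_pmf (scan f c \<sigma> s)" "J 0 s"
    and "\<And>i s s'. i < length \<sigma> \<Longrightarrow> J i s \<Longrightarrow> s' \<in> set_pmf (exec f (Some (\<sigma> ! i)) c s) \<Longrightarrow> J (Suc i) s'"
  shows "J (length \<sigma>) s'"
  using assms
proof (induction \<sigma> arbitrary: J s)
  case (Cons x \<sigma>)
  from Cons.prems(1) obtain s1
    where s1: "s1 \<in> set_pmf (exec f (Some x) c s)" "s' \<in> set_pmf (scan f c \<sigma> s1)"
    by auto
  have "J (Suc (length \<sigma>)) s'"
  proof (rule Cons.IH[of s1 "\<lambda>i. J (Suc i)"])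
    show "J (Suc 0) s1" using Cons.prems(3)[of 0 s s1] Cons.prems(2) s1 by simp
    show "J (Suc (Suc i)) s''"
      if "i < length \<sigma>" "J (Suc i) s'''" "s'' \<in> set_pmf (exec f (Some (\<sigma> ! i)) c s''')" for i s''' s''
      using Cons.prems(3)[of "Suc i" s''' s''] that by simp
  qed (use s1 in auto)
  then show ?case by simp
qed simp

text \<open>A loop with fresh draws is the same as drawing all values in advance and folding the
  updates. \<open>I\<close> restricts the claim to states in which the body really acts as
  \<open>g\<close> on one draw.\<close>

lemma iterate_replicate_pmf:
  assumes "I s" "\<And>s. I s \<Longrightarrow> k s = map_pmf (\<lambda>x. g x s) D" "\<And>x s. I s \<Longrightarrow> I (g x s)"
  shows "iterate m k s = map_pmf (\<lambda>xs. fold g xs s) (replicate_pmf m D)"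
  using assms(1)
proof (induction m arbitrary: s)
  case (Suc m)
  have "iterate (Suc m) k s = bind_pmf D (\<lambda>x. iterate m k (g x s))"
    by (simp add: assms(2)[OF Suc.prems] bind_map_pmf)
  also have "\<dots> = bind_pmf D (\<lambda>x. map_pmf (\<lambda>xs. fold g xs (g x s)) (replicate_pmf m D))"
    by (intro bind_pmf_cong refl Suc.IH assms(3) Suc.prems)
  also have "\<dots> = map_pmf (\<lambda>xs. fold g xs s) (replicate_pmf (Suc m) D)"
    by (simp add: map_bind_pmf map_pmf_def bind_return_pmf bind_assoc_pmf)
  finally show ?case .
qed simp

text \<open>
  Register file: 0 holds \<open>n\<close> and finally the output, 1 holds \<open>\<epsilon>\<close>, 2 the sample size, 3 a pointer into
  the arrays, 5 the constant 1, 6 the number of items seen in the first pass, 7 the threshold,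
  8 its \<open>p\<close>-th power, 11 the sum of the excesses, 12 the sum over the sample, 13 holds \<open>p\<close>;
  4, 9 and 10 are scratch. Both arrays start at address 14. The number array holds first the sampled
  positions, then the degrees of the sampled nodes.
\<close>

abbreviation block :: "command list \<Rightarrow> command" where
  "block cs \<equiv> foldr Seq cs Skip"

abbreviation reg :: "nat \<Rightarrow> address" where "reg \<equiv> Direct"

abbreviation cell :: address where "cell \<equiv> Indirect 3"

section \<open>The commands of the two-pass program\<close>

definition advance :: command where
  "advance = Arith Add (reg 3) (reg 3) (reg 5)"

definition foreach :: "command list \<Rightarrow> command" where
  "foreach cs = Seq (Const (reg 3) 14) (Repeat (reg 2) (Seq (block cs) advance))"

text \<open>The number left in register 2 is the sample size required for
  \<open>h = \<epsilon> / error_factor p\<close>, plus 1 so that truncation cannot fall below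
  it.\<close>

definition initialise :: "real \<Rightarrow> command" where
  "initialise p = block
    [Const (reg 13) p, Const (reg 5) 1, Const (reg 3) 14,
     Const (reg 7) (1 / (p + 1)), Arith Pow (reg 7) (reg 0) (reg 7), Arith Pow (reg 8) (reg 7) (reg 13),
     Const (reg 4) 400, Arith Mul (reg 4) (reg 4) (reg 0), Log (reg 4) (reg 4),
     Const (reg 9) (4 * (error_factor p)\<^sup>2), Arith Mul (reg 9) (reg 9) (reg 8),
     Arith Mul (reg 9) (reg 9) (reg 4), Arith Mul (reg 10) (reg 1) (reg 1),
     Arith Div (reg 9) (reg 9) (reg 10), Arith Add (reg 2) (reg 9) (reg 5)]"

text \<open>Register 2 may hold a non-integer at first. It is replaced by the distance travelled by
  the pointer, the exact number of draws, because it later serves as a divisor.\<close>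

definition draw_sample :: command where
  "draw_sample = block
    [Repeat (reg 2) (Seq (Random cell (reg 0)) advance),
     Const (reg 4) 14, Arith Sub (reg 2) (reg 3) (reg 4)]"

text \<open>A cell is overwritten by every arrival up to its sampled position and frozen afterwards,
  so it ends with the right item although only a strict comparison is available.\<close>

definition collect :: command where
  "collect = block
    [foreach [IfLess cell (reg 6) Skip (Store cell Arriving)],
     Arith Add (reg 6) (reg 6) (reg 5)]"

text \<open>Once the items are stored, the positions can be discarded and their cells reused as
  degree accumulators.\<close>

definition clear :: command where
  "clear = foreach [Const cell 0]"

text \<open>Each query serves twice: it enters the estimated degree of the arriving node and the
  exact degree of a sampled node.\<close>

definition measure_degrees :: command where
  "measure_degrees = block
    [Const (reg 9) 0,
     foreach [Query (reg 10) Arriving (Stored cell), Arith Add (reg 9) (reg 9) (reg 10),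
       Arith Add cell cell (reg 10)],
     Arith Mul (reg 9) (reg 9) (reg 0), Arith Div (reg 9) (reg 9) (reg 2),
     IfLess (reg 7) (reg 9)
       (block [Arith Pow (reg 9) (reg 9) (reg 13), Arith Sub (reg 9) (reg 9) (reg 8),
         Arith Add (reg 11) (reg 11) (reg 9)])
       Skip]"

definition combine :: command where
  "combine = block
    [foreach [Arith Pow (reg 10) cell (reg 13),
       IfLess (reg 10) (reg 8) (Arith Add (reg 12) (reg 12) (reg 10))
         (Arith Add (reg 12) (reg 12) (reg 8))],
     Arith Mul (reg 12) (reg 12) (reg 0), Arith Div (reg 12) (reg 12) (reg 2),
     Arith Add (reg 0) (reg 11) (reg 12)]"

definition moment_algorithm :: "real \<Rightarrow> algorithm" where
  "moment_algorithm p =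
    \<lparr>prepare = Seq (initialise p) draw_sample,
     passes = [(collect, clear), (measure_degrees, combine)]\<rparr>"

definition sample_size :: "real \<Rightarrow> nat \<Rightarrow> real \<Rightarrow> nat" where
  "sample_size p n \<epsilon> =
    nat \<lfloor>4 * (error_factor p)\<^sup>2 * threshold p n powr p * ln (400 * n) / \<epsilon>\<^sup>2 + 1\<rfloor>"

text \<open>The scratch registers and the pointer are left unconstrained, so writing to them
  preserves the predicate; the contents of the item bank are tracked separately.\<close>

definition layout ::
  "real \<Rightarrow> nat \<Rightarrow> nat \<Rightarrow> real \<Rightarrow> real \<Rightarrow> real \<Rightarrow> (nat \<Rightarrow> real) \<Rightarrow> 'u memory \<Rightarrow> bool" where
  "layout p n m seen excesses acc A s \<longleftrightarrow>
     nums s 0 = n \<and> nums s 2 = m \<and> nums s 5 = 1 \<and> nums s 7 = threshold p n \<and>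
     nums s 8 = threshold p n powr p \<and> nums s 13 = p \<and>
     nums s 6 = seen \<and> nums s 11 = excesses \<and> nums s 12 = acc \<and>
     (\<forall>t<m. nums s (14 + t) = A t) \<and> nums_used s \<le> 14 + m \<and> items_used s \<le> 14 + m"

lemma nat_cell [simp]: "nat (14 + int t) = 14 + t"
  by simp

lemma foreach_invariant:
  assumes "s' \<in> set_pmf (exec f cur (foreach cs) s)" "nums s 2 = real m" "I 0 (write_num 3 14 s)"
    and "\<And>t s s'. t < m \<Longrightarrow> I t s \<Longrightarrow> s' \<in> set_pmf (exec f cur (Seq (block cs) advance) s) \<Longrightarrow> I (Suc t) s'"
  shows "I m s'"
proof -
  have "s' \<in> set_pmf (iterate m (exec f cur (Seq (block cs) advance)) (write_num 3 14 s))"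
    using assms(1,2) by (simp add: foreach_def read_num_def bind_return_pmf)
  then show ?thesis by (rule iterate_invariant) (use assms(3,4) in auto)
qed

text \<open>The deterministic effect of one sampling round once the drawn value is fixed.\<close>

definition push :: "nat \<Rightarrow> 'u memory \<Rightarrow> 'u memory" where
  "push k s = write_num 3 (nums s 3 + 1) (write_num (nat \<lfloor>nums s 3\<rfloor>) (real k) s)"

text \<open>The offset \<open>r\<close> counts entries already present; it is general so that one
  joint induction can pass to \<open>Suc r\<close>. Addresses below \<open>14 + r\<close> include
  these earlier entries.\<close>

lemma fold_push:
  assumes "nums s 3 = 14 + real r"
  defines "s' \<equiv> \<lambda>xs. fold push xs s"
  shows "nums (s' xs) 3 = 14 + real (r + length xs)"
    and "k < 14 + r \<Longrightarrow> k \<noteq> 3 \<Longrightarrow> nums (s' xs) k = nums s k"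
    and "t < length xs \<Longrightarrow> nums (s' xs) (14 + r + t) = real (xs ! t)"
    and "nums_used s \<le> 14 + r \<Longrightarrow> nums_used (s' xs) \<le> 14 + r + length xs"
    and "items_used (s' xs) = items_used s"
proof -
  have "nums (fold push xs s) 3 = 14 + real (r + length xs) \<and>
    (\<forall>k. k < 14 + r \<longrightarrow> k \<noteq> 3 \<longrightarrow> nums (fold push xs s) k = nums s k) \<and>
    (\<forall>t<length xs. nums (fold push xs s) (14 + r + t) = real (xs ! t)) \<and>
    (nums_used s \<le> 14 + r \<longrightarrow> nums_used (fold push xs s) \<le> 14 + r + length xs) \<and>
    items_used (fold push xs s) = items_used s"
    using assms(1)
  proof (induction xs arbitrary: s r)
    case (Cons x xs)
    have "nums (push x s) 3 = 14 + real (Suc r)" using Cons.prems by (simp add: push_def)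
    note IH = Cons.IH[OF this]
    have eq: "nums (push x s) (14 + r) = real x" using Cons.prems by (simp add: push_def)
    have "nums (push x s) k = nums s k" if "k < 14 + r" "k \<noteq> 3" for k
      using that Cons.prems by (simp add: push_def)
    moreover have "nums_used (push x s) \<le> 14 + Suc r" if "nums_used s \<le> 14 + r"
      using that Cons.prems by (simp add: push_def)
    moreover have "items_used (push x s) = items_used s" by (simp add: push_def)
    moreover have "nums (fold push xs (push x s)) (14 + r + t) = real ((x # xs) ! t)"
      if "t < Suc (length xs)" for t
    proof (cases t)
      case 0
      then show ?thesis using IH eq by simp
    next
      case (Suc u)
      then have "14 + r + t = 14 + Suc r + u" by simp
      then show ?thesis using IH that Suc by (simp only:) simp
    qed
    ultimately show ?case using IH by (simp add: add.assoc)
  qed simp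
  then show "nums (s' xs) 3 = 14 + real (r + length xs)"
    and "k < 14 + r \<Longrightarrow> k \<noteq> 3 \<Longrightarrow> nums (s' xs) k = nums s k"
    and "t < length xs \<Longrightarrow> nums (s' xs) (14 + r + t) = real (xs ! t)"
    and "nums_used s \<le> 14 + r \<Longrightarrow> nums_used (s' xs) \<le> 14 + r + length xs"
    and "items_used (s' xs) = items_used s"
    by (auto simp: s'_def)
qed

text \<open>Only the integer part of register 2 is described here, as the exact count is set after
  sampling.\<close>

lemma exec_initialise:
  "\<exists>s. exec f None (initialise p) (initial n \<epsilon>) = return_pmf s \<and>
    nums s 0 = n \<and> nums s 3 = 14 \<and> nums s 5 = 1 \<and> nums s 7 = threshold p n \<and>
    nums s 8 = threshold p n powr p \<and> nums s 13 = p \<and> nums s 6 = 0 \<and> nums s 11 = 0 \<and> nums s 12 = 0 \<and>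
    nat \<lfloor>nums s 2\<rfloor> = sample_size p n \<epsilon> \<and> nums_used s = 14 \<and> items_used s = 0"
  by (simp add: initialise_def bind_return_pmf read_num_def initial_def threshold_def
      sample_size_def power2_eq_square)

text \<open>All randomness of the algorithm is isolated here: the memory is a function
  \<open>S\<close> of the sampled positions, and what follows is deterministic.\<close>

lemma exec_prepare:
  assumes n: "n \<ge> 1" and m: "m = sample_size p n \<epsilon>"
  obtains S :: "nat list \<Rightarrow> 'u memory" where
    "exec f None (prepare (moment_algorithm p)) (initial n \<epsilon>)
      = map_pmf S (replicate_pmf m (pmf_of_set {..<n}))"
    and "\<And>xs. length xs = m \<Longrightarrow> layout p n m 0 0 0 (\<lambda>t. real (xs ! t)) (S xs)"
proof -
  obtain s :: "'u memory" where exec: "exec f None (initialise p) (initial n \<epsilon>) = return_pmf s"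
    and s: "nums s 0 = n" "nums s 3 = 14" "nums s 5 = 1" "nums s 7 = threshold p n"
    "nums s 8 = threshold p n powr p" "nums s 13 = p" "nums s 6 = 0" "nums s 11 = 0" "nums s 12 = 0"
    "nat \<lfloor>nums s 2\<rfloor> = sample_size p n \<epsilon>" "nums_used s = 14" "items_used s = 0"
    using exec_initialise[of f p n \<epsilon>] by blast
  define S where "S xs = (let s' = write_num 4 14 (fold push xs s)
    in write_num 2 (nums s' 3 - 14) s')" for xs
  \<comment> \<open>The form of the pointer guarantees that a draw never overwrites the registers
    holding \<open>n\<close> and 1.\<close>
  define I :: "'u memory \<Rightarrow> bool"
    where "I s \<longleftrightarrow> nums s 0 = n \<and> nums s 5 = 1 \<and> (\<exists>r::nat. nums s 3 = 14 + real r)" for s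
  have "iterate m (exec f None (Seq (Random cell (reg 0)) advance)) s
    = map_pmf (\<lambda>xs. fold push xs s) (replicate_pmf m (pmf_of_set {..<n}))"
  proof (rule iterate_replicate_pmf[where I = I])
    show "I s" using s by (auto simp: I_def intro: exI[of _ 0])
    show "exec f None (Seq (Random cell (reg 0)) advance) s = map_pmf (\<lambda>x. push x s) (pmf_of_set {..<n})"
      if "I s" for s :: "'u memory"
      using that n unfolding I_def
      by (auto simp: read_num_def advance_def push_def map_pmf_def bind_assoc_pmf bind_return_pmf)
    show "I (push x s)" if "I s" for x s
    proof -
      from that obtain r where "nums s 3 = 14 + real r" by (auto simp: I_def)
      then show ?thesis using that by (auto simp: I_def push_def intro: exI[of _ "Suc r"])
    qed
  qed
  then have "exec f None (prepare (moment_algorithm p)) (initial n \<epsilon>)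
      = map_pmf S (replicate_pmf m (pmf_of_set {..<n}))"
    by (simp add: moment_algorithm_def draw_sample_def exec bind_return_pmf read_num_def s m S_def
        map_pmf_def bind_assoc_pmf Let_def)
  moreover have "layout p n m 0 0 0 (\<lambda>t. real (xs ! t)) (S xs)" if "length xs = m" for xs
    using fold_push[of s 0, where xs = xs] that s by (simp add: layout_def S_def Let_def)
  ultimately show ?thesis using that by blast
qed

section \<open>Effect of each command on the memory\<close>

lemma layout_sample_size: "layout p n m seen excesses acc A s \<Longrightarrow> nums s 2 = m"
  by (simp add: layout_def)

lemma layout_scratch:
  assumes "layout p n m seen excesses acc A s" "a \<in> {3, 4, 9, 10}"
  shows "layout p n m seen excesses acc A (write_num a v s)"
  using assms by (auto simp: layout_def)

lemma collect_step:
  assumes s': "s' \<in> set_pmf (exec f (Some (\<sigma> ! i)) collect s)"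
    and s: "layout p n m i 0 0 (\<lambda>t. real (xs ! t)) s"
      "\<forall>t<m. xs ! t < i \<longrightarrow> items s (14 + t) = Some (\<sigma> ! (xs ! t))"
  shows "layout p n m (Suc i) 0 0 (\<lambda>t. real (xs ! t)) s' \<and>
    (\<forall>t<m. xs ! t < Suc i \<longrightarrow> items s' (14 + t) = Some (\<sigma> ! (xs ! t)))"
proof -
  let ?loop = "foreach [IfLess cell (reg 6) Skip (Store cell Arriving)]"
  \<comment> \<open>Cells before the pointer have already handled arrival \<open>i\<close>, the
    others have not.\<close>
  define I where "I t s \<longleftrightarrow> layout p n m i 0 0 (\<lambda>t. real (xs ! t)) s \<and> nums s 3 = 14 + real t \<and>
    (\<forall>k<m. xs ! k < (if k < t then Suc i else i) \<longrightarrow> items s (14 + k) = Some (\<sigma> ! (xs ! k)))"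
    for t and s :: "'a memory"
  from s' obtain s1 where s1: "s1 \<in> set_pmf (exec f (Some (\<sigma> ! i)) ?loop s)"
    and s'_eq: "s' = write_num 6 (nums s1 6 + nums s1 5) s1"
    by (auto simp: collect_def read_num_def)
  have "I m s1"
  proof (rule foreach_invariant[OF s1])
    show "nums s 2 = m" by (rule layout_sample_size[OF s(1)])
    show "I 0 (write_num 3 14 s)" using s by (simp add: I_def layout_scratch)
  next
    fix t s s' assume t: "t < m" and I: "I t s"
      and s': "s' \<in> set_pmf (exec f (Some (\<sigma> ! i))
        (Seq (block [IfLess cell (reg 6) Skip (Store cell Arriving)]) advance) s)"
    then show "I (Suc t) s'"
      by (auto simp: I_def layout_def read_num_def advance_def less_Suc_eq split: if_splits)
  qed
  then show ?thesis unfolding s'_eq I_def by (auto simp: layout_def)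
qed

lemma clear_effect:
  assumes s': "s' \<in> set_pmf (exec f None clear s)"
    and s: "layout p n m seen 0 0 A s" "\<forall>t<m. items s (14 + t) = H t"
  shows "layout p n m seen 0 0 (\<lambda>_. 0) s' \<and> (\<forall>t<m. items s' (14 + t) = H t)"
proof -
  define I where "I t s \<longleftrightarrow> layout p n m seen 0 0 (\<lambda>k. if k < t then 0 else A k) s \<and>
    nums s 3 = 14 + real t \<and> (\<forall>k<m. items s (14 + k) = H k)" for t and s :: "'a memory"
  have "I m s'"
  proof (rule foreach_invariant[OF s'[unfolded clear_def]])
    show "nums s 2 = m" by (rule layout_sample_size[OF s(1)])
    show "I 0 (write_num 3 14 s)" using s by (simp add: I_def layout_scratch)
  next
    fix t s s' assume t: "t < m" and I: "I t s"
      and s': "s' \<in> set_pmf (exec f None (Seq (block [Const cell 0]) advance) s)"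
    then show "I (Suc t) s'"
      by (auto simp: I_def layout_def read_num_def advance_def less_Suc_eq bind_return_pmf)
  qed
  then show ?thesis by (auto simp: I_def layout_def)
qed

lemma sum_list_nth: "(\<Sum>x\<leftarrow>xs. g x) = (\<Sum>k<length xs. g (xs ! k))"
  for g :: "'a \<Rightarrow> real"
  by (simp add: sum_list_sum_nth atLeast0LessThan)

lemma measure_degrees_step:
  assumes s': "s' \<in> set_pmf (exec f (Some (\<sigma> ! j)) measure_degrees s)"
    and n: "n = length \<sigma>" and m: "m = length xs"
    and s: "layout p n m seen E 0 (\<lambda>k. \<Sum>i<j. weight f \<sigma> i (xs ! k)) s"
      "\<forall>t<m. items s (14 + t) = Some (\<sigma> ! (xs ! t))"
  shows "layout p n m seen (E + excess p (threshold p n) (degree_estimate f \<sigma> xs j)) 0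
      (\<lambda>k. \<Sum>i<Suc j. weight f \<sigma> i (xs ! k)) s' \<and>
    (\<forall>t<m. items s' (14 + t) = Some (\<sigma> ! (xs ! t)))"
proof -
  let ?body = "[Query (reg 10) Arriving (Stored cell), Arith Add (reg 9) (reg 9) (reg 10),
    Arith Add cell cell (reg 10)]"
  let ?rest = "[Arith Mul (reg 9) (reg 9) (reg 0), Arith Div (reg 9) (reg 9) (reg 2),
     IfLess (reg 7) (reg 9)
       (block [Arith Pow (reg 9) (reg 9) (reg 13), Arith Sub (reg 9) (reg 9) (reg 8),
         Arith Add (reg 11) (reg 11) (reg 9)])
       Skip]"
  \<comment> \<open>Accumulators before the pointer already include arrival \<open>j\<close>, while
    register 9 holds the similarity of that arrival to the same part of the sample.\<close>
  define I where "I t s \<longleftrightarrow>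
    layout p n m seen E 0 (\<lambda>k. \<Sum>i<(if k < t then Suc j else j). weight f \<sigma> i (xs ! k)) s \<and>
    nums s 3 = 14 + real t \<and> nums s 9 = (\<Sum>k<t. weight f \<sigma> j (xs ! k)) \<and>
    (\<forall>k<m. items s (14 + k) = Some (\<sigma> ! (xs ! k)))" for t and s :: "'a memory"
  define s0 where "s0 = write_num 9 0 s"
  have "set_pmf (exec f (Some (\<sigma> ! j)) measure_degrees s)
      = (\<Union>s1\<in>set_pmf (exec f (Some (\<sigma> ! j)) (foreach ?body) s0).
          set_pmf (exec f (Some (\<sigma> ! j)) (block ?rest) s1))"
    by (simp add: measure_degrees_def s0_def bind_return_pmf)
  with s' obtain s1 where s1: "s1 \<in> set_pmf (exec f (Some (\<sigma> ! j)) (foreach ?body) s0)"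
    and s'1: "s' \<in> set_pmf (exec f (Some (\<sigma> ! j)) (block ?rest) s1)"
    by blast
  have "I m s1"
  proof (rule foreach_invariant[OF s1])
    show "nums s0 2 = m" using s(1) by (simp add: s0_def layout_def)
    show "I 0 (write_num 3 14 s0)" using s by (simp add: I_def s0_def layout_scratch)
  next
    fix t s s' assume t: "t < m" and I: "I t s"
      and s': "s' \<in> set_pmf (exec f (Some (\<sigma> ! j)) (Seq (block ?body) advance) s)"
    then show "I (Suc t) s'"
      by (auto simp: I_def layout_def read_num_def advance_def less_Suc_eq bind_return_pmf
          weight_def)
  qed
  moreover have "degree_estimate f \<sigma> xs j = (\<Sum>k<m. weight f \<sigma> j (xs ! k)) * n / m"
    by (simp add: degree_estimate_def sum_list_nth m n)
  ultimately show ?thesis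
    using s'1 by (auto simp: I_def layout_def excess_def read_num_def bind_return_pmf split: if_splits)
qed

lemma combine_effect:
  assumes s': "s' \<in> set_pmf (exec f None combine s)"
    and s: "layout p n m seen E 0 A s"
  shows "result s' = E + (\<Sum>k<m. min (A k powr p) (threshold p n powr p)) * n / m"
    and "nums_used s' \<le> 14 + m" and "items_used s' \<le> 14 + m"
proof -
  let ?body = "[Arith Pow (reg 10) cell (reg 13),
    IfLess (reg 10) (reg 8) (Arith Add (reg 12) (reg 12) (reg 10))
      (Arith Add (reg 12) (reg 12) (reg 8))]"
  define I where "I t s \<longleftrightarrow>
    layout p n m seen E (\<Sum>k<t. min (A k powr p) (threshold p n powr p)) A s \<and>
    nums s 3 = 14 + real t" for t and s :: "'a memory"
  from s' obtain s1 where s1: "s1 \<in> set_pmf (exec f None (foreach ?body) s)"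
    and s'1: "s' = (let s2 = write_num 12 (nums s1 12 * nums s1 0) s1;
        s3 = write_num 12 (nums s2 12 / nums s2 2) s2
      in write_num 0 (nums s3 11 + nums s3 12) s3)"
    by (auto simp: combine_def read_num_def bind_return_pmf Let_def)
  have "I m s1"
  proof (rule foreach_invariant[OF s1])
    show "nums s 2 = m" by (rule layout_sample_size[OF s])
    show "I 0 (write_num 3 14 s)" using s by (simp add: I_def layout_scratch)
  next
    fix t s s' assume t: "t < m" and I: "I t s"
      and s': "s' \<in> set_pmf (exec f None (Seq (block ?body) advance) s)"
    then show "I (Suc t) s'"
      by (auto simp: I_def layout_def read_num_def advance_def bind_return_pmf split: if_splits)
  qed
  then show "result s' = E + (\<Sum>k<m. min (A k powr p) (threshold p n powr p)) * n / m"
    and "nums_used s' \<le> 14 + m" and "items_used s' \<le> 14 + m"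
    unfolding s'1 by (auto simp: I_def layout_def Let_def result_def)
qed

text \<open>For a fixed sample every possible final memory carries the same output, so the passes
  act as a deterministic evaluation of the estimator.\<close>

lemma run_passes_effect:
  assumes sim: "similarity U f" "set \<sigma> \<subseteq> U" and n: "n = length \<sigma>" and m: "m = length xs"
    and xs: "set xs \<subseteq> {..<n}"
    and s: "layout p n m 0 0 0 (\<lambda>t. real (xs ! t)) s"
    and s': "s' \<in> set_pmf (run_passes f \<sigma> (passes (moment_algorithm p)) s)"
  shows "result s' = moment_estimate p f \<sigma> xs"
    and "nums_used s' \<le> 14 + m" and "items_used s' \<le> 14 + m"
proof -
  from s' obtain s1 s2 s3
    where s1: "s1 \<in> set_pmf (scan f collect \<sigma> s)"
      and s2: "s2 \<in> set_pmf (exec f None clear s1)"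
      and s3: "s3 \<in> set_pmf (scan f measure_degrees \<sigma> s2)"
      and s4: "s' \<in> set_pmf (exec f None combine s3)"
    by (auto simp: moment_algorithm_def)
  have bound: "xs ! t < n" if "t < m" for t
    using xs that m nth_mem by blast
  define J1 where "J1 i s \<longleftrightarrow> layout p n m (real i) 0 0 (\<lambda>t. real (xs ! t)) s \<and>
    (\<forall>t<m. xs ! t < i \<longrightarrow> items s (14 + t) = Some (\<sigma> ! (xs ! t)))" for i and s :: "'a memory"
  have "J1 (length \<sigma>) s1"
    by (rule scan_invariant[OF s1]) (use s collect_step[of _ f \<sigma>] in \<open>auto simp: J1_def\<close>)
  \<comment> \<open>All sampled positions are below \<open>n\<close>, so after the full scan every
    item cell is final.\<close>
  then have l1: "layout p n m (real n) 0 0 (\<lambda>t. real (xs ! t)) s1"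
    and i1: "\<forall>t<m. items s1 (14 + t) = Some (\<sigma> ! (xs ! t))"
    using bound by (auto simp: J1_def n)
  note l2 = clear_effect[OF s2 l1 i1]
  define J2 where "J2 j s \<longleftrightarrow> layout p n m (real n)
      (\<Sum>i<j. excess p (threshold p n) (degree_estimate f \<sigma> xs i)) 0
      (\<lambda>k. \<Sum>i<j. weight f \<sigma> i (xs ! k)) s \<and>
    (\<forall>t<m. items s (14 + t) = Some (\<sigma> ! (xs ! t)))" for j and s :: "'a memory"
  have "J2 (length \<sigma>) s3"
  proof (rule scan_invariant[OF s3])
    show "J2 0 s2" using l2 by (simp add: J2_def)
    show "J2 (Suc j) s'" if "J2 j s" "s' \<in> set_pmf (exec f (Some (\<sigma> ! j)) measure_degrees s)" for j s s'
      using measure_degrees_step[OF that(2) n m] that(1) unfolding J2_def sum.lessThan_Suc by blast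
  qed
  then have l3: "layout p n m (real n)
      (\<Sum>i<n. excess p (threshold p n) (degree_estimate f \<sigma> xs i)) 0
      (\<lambda>k. \<Sum>i<n. weight f \<sigma> i (xs ! k)) s3"
    by (simp add: J2_def n)
  \<comment> \<open>The accumulators sum over the first argument, that of the arriving item;
    symmetry turns these sums into degrees.\<close>
  have "(\<Sum>i<n. weight f \<sigma> i (xs ! k)) = node_degree f \<sigma> (xs ! k)" if "k < m" for k
    unfolding node_degree_def using bound[OF that] weight_commute[OF sim] by (auto intro: sum.cong simp: n)
  then have "(\<Sum>k<m. min ((\<Sum>i<n. weight f \<sigma> i (xs ! k)) powr p) (threshold p n powr p))
      = (\<Sum>x\<leftarrow>xs. capped p f \<sigma> x)"
    by (simp add: sum_list_nth capped_def n m)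
  then show "result s' = moment_estimate p f \<sigma> xs"
    using combine_effect(1)[OF s4 l3] by (simp add: moment_estimate_def n m)
  show "nums_used s' \<le> 14 + m" "items_used s' \<le> 14 + m"
    by (rule combine_effect[OF s4 l3])+
qed

text \<open>Transfers the concentration of the estimator to the output law of the program. The space
  bound holds on the whole support, with \<open>14 + m\<close> cells per bank.\<close>

lemma run_moment_algorithm:
  assumes sim: "similarity U f" "set \<sigma> \<subseteq> U" and n: "n = length \<sigma>" "n \<ge> 1"
    and m: "m = sample_size p n \<epsilon>"
  shows "map_pmf result (run (moment_algorithm p) f \<epsilon> \<sigma>)
      = map_pmf (moment_estimate p f \<sigma>) (replicate_pmf m (pmf_of_set {..<n}))"
    and "s \<in> set_pmf (run (moment_algorithm p) f \<epsilon> \<sigma>) \<Longrightarrow> nums_used s + items_used s \<le> 28 + 2 * m"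
proof -
  obtain S :: "nat list \<Rightarrow> 'a memory" where prep:
    "exec f None (prepare (moment_algorithm p)) (initial n \<epsilon>)
      = map_pmf S (replicate_pmf m (pmf_of_set {..<n}))"
    and S: "\<And>xs. length xs = m \<Longrightarrow> layout p n m 0 0 0 (\<lambda>t. real (xs ! t)) (S xs)"
    using exec_prepare[where f = f, OF n(2) m] by blast
  let ?R = "replicate_pmf m (pmf_of_set {..<n})"
  let ?pass = "run_passes f \<sigma> (passes (moment_algorithm p))"
  have run: "run (moment_algorithm p) f \<epsilon> \<sigma> = bind_pmf ?R (\<lambda>xs. ?pass (S xs))"
    by (simp only: run_def n(1)[symmetric] prep bind_map_pmf)
  have R: "m = length xs" "set xs \<subseteq> {..<n}" if "xs \<in> set_pmf ?R" for xs
    using that n(2) by (auto simp: set_replicate_pmf set_pmf_of_set lessThan_empty_iff)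
  note effect = run_passes_effect[OF sim n(1) R(1) R(2) S[OF R(1)[symmetric]]]
  have "map_pmf result (?pass (S xs)) = return_pmf (moment_estimate p f \<sigma> xs)"
    if "xs \<in> set_pmf ?R" for xs
    using effect(1)[OF that that that] by (auto simp: map_pmf_const intro: map_pmf_cong[THEN trans])
  then show "map_pmf result (run (moment_algorithm p) f \<epsilon> \<sigma>) = map_pmf (moment_estimate p f \<sigma>) ?R"
    unfolding run map_bind_pmf map_pmf_def[of "moment_estimate p f \<sigma>"]
    by (intro bind_pmf_cong refl)
  assume "s \<in> set_pmf (run (moment_algorithm p) f \<epsilon> \<sigma>)"
  then obtain xs where xs: "xs \<in> set_pmf ?R" "s \<in> set_pmf (?pass (S xs))"
    by (auto simp: run)
  show "nums_used s + items_used s \<le> 28 + 2 * m"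
    using effect(2,3)[OF xs(1) xs(1) xs(1) xs(2)] by simp
qed

section \<open>Space bound and conclusion\<close>

lemma real_sample_size:
  fixes x \<epsilon> :: real
  assumes "p > 0" "n \<ge> 1"
  defines "x \<equiv> 4 * (error_factor p)\<^sup>2 * threshold p n powr p * ln (400 * n) / \<epsilon>\<^sup>2"
  shows "x \<le> sample_size p n \<epsilon>" "sample_size p n \<epsilon> \<le> x + 1"
proof -
  have "0 \<le> ln (400 * real n)" using assms(2) by (intro ln_ge_zero) simp
  then have "0 \<le> x" by (simp add: x_def)
  then show "x \<le> sample_size p n \<epsilon>" "sample_size p n \<epsilon> \<le> x + 1"
    unfolding sample_size_def x_def[symmetric] by linarith+
qed

lemma counters_moment_algorithm: "counters (moment_algorithm p) = 1"
  by (simp add: counters_def moment_algorithm_def initialise_def draw_sample_def collect_def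
      clear_def measure_degrees_def combine_def foreach_def advance_def)

text \<open>For \<open>n\<close> at least 2 the logarithm is bounded away from 0, so the additive
  constants can be absorbed into the main term.\<close>

lemma space_bound:
  fixes \<epsilon> :: real
  assumes p: "p > 0" and n: "n \<ge> 2" and e: "0 < \<epsilon>" "\<epsilon> < 1"
  shows "32 + 2 * real (sample_size p n \<epsilon>)
    \<le> (80 * (error_factor p)\<^sup>2 + 68) * (1 / \<epsilon>\<^sup>2 * n powr (1 - 1 / (p + 1)) * ln n)"
proof -
  define K where "K = threshold p n powr p"
  define F where "F = (error_factor p)\<^sup>2"
  have K: "K \<ge> 1" using threshold_ge_1[OF p] n by (simp add: K_def)
  have ln2: "1 / 2 \<le> ln (real n)"
  proof -
    have "1 / 2 \<le> ln (2::real)" using exp_half_le2 by (subst ln_ge_iff) auto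
    also have "\<dots> \<le> ln n" using n by simp
    finally show ?thesis .
  qed
  \<comment> \<open>The exponent 10 comes from \<open>400 \<le> 2 ^ 9\<close>.\<close>
  have "ln (400 * real n) \<le> ln (real n ^ 10)"
  proof (subst ln_le_cancel_iff)
    have "2 ^ 9 \<le> real n ^ 9" using n by (intro power_mono) auto
    then have "400 * real n \<le> real n ^ 9 * real n" by (intro mult_right_mono) auto
    then show "400 * real n \<le> real n ^ 10" by (simp add: eval_nat_numeral mult_ac)
  qed (use n in auto)
  also have "\<dots> = 10 * ln n" using n by (simp add: ln_realpow)
  finally have ln400: "ln (400 * real n) \<le> 10 * ln n" .
  define W where "W = 1 / \<epsilon>\<^sup>2 * K * ln n"
  have e2: "1 \<le> 1 / \<epsilon>\<^sup>2" using e by (simp add: power_le_one)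
  \<comment> \<open>This gives \<open>1 \<le> 2 * W\<close>, by which the constant 34 is charged as
    \<open>68 * W\<close>.\<close>
  have "1 * (1 * (1 / 2)) \<le> 1 / \<epsilon>\<^sup>2 * (K * ln n)"
    using e2 K ln2 by (intro mult_mono) auto
  then have W: "1 \<le> 2 * W" by (simp add: W_def mult_ac)
  have "4 * F * K * ln (400 * n) / \<epsilon>\<^sup>2 \<le> 4 * F * K * (10 * ln n) / \<epsilon>\<^sup>2"
    using ln400 K by (intro divide_right_mono mult_left_mono) (auto simp: F_def)
  also have "\<dots> = 40 * F * W" by (simp add: W_def)
  finally have "sample_size p n \<epsilon> \<le> 40 * F * W + 1"
    using real_sample_size(2)[OF p, of n \<epsilon>] n by (simp add: F_def K_def)
  then have "32 + 2 * real (sample_size p n \<epsilon>) \<le> 80 * F * W + 34" by simp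
  also have "\<dots> \<le> (80 * F + 68) * W" using W by (simp add: distrib_right)
  finally show ?thesis by (simp add: W_def K_def F_def threshold_powr[OF p])
qed

theorem theorem7:
  fixes p :: real
  assumes "p > 0"
  shows "\<exists>(A :: algorithm) (C :: real).
    length (passes A) = 2 \<and>
    (\<forall>(U :: 'u set) (f :: 'u \<Rightarrow> 'u \<Rightarrow> real) (n :: nat) (\<sigma> :: 'u list) (\<epsilon> :: real).
       similarity U f \<and> n \<ge> 1 \<and> length \<sigma> = n \<and> set \<sigma> \<subseteq> U \<and> 0 < \<epsilon> \<and> \<epsilon> < 1 \<longrightarrow>
         approximates \<epsilon> 0.01 (map_pmf result (run A f \<epsilon> \<sigma>)) (degree_moment p f \<sigma>) \<and>
         (n \<ge> 2 \<longrightarrow>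
           (\<forall>s\<in>set_pmf (run A f \<epsilon> \<sigma>).
              real (words_used A s) \<le> C * (1 / \<epsilon>\<^sup>2 * real n powr (1 - 1 / (p + 1)) * ln (real n)))))"
proof (intro exI conjI allI impI ballI)
  show "length (passes (moment_algorithm p)) = 2" by (simp add: moment_algorithm_def)
next
  fix U :: "'u set" and f :: "'u \<Rightarrow> 'u \<Rightarrow> real" and n and \<sigma> :: "'u list" and \<epsilon> :: real
  assume "similarity U f \<and> n \<ge> 1 \<and> length \<sigma> = n \<and> set \<sigma> \<subseteq> U \<and> 0 < \<epsilon> \<and> \<epsilon> < 1"
  then have sim: "similarity U f" "set \<sigma> \<subseteq> U" and n: "n = length \<sigma>" "n \<ge> 1"
    and e: "0 < \<epsilon>" "\<epsilon> < 1" by auto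
  note run = run_moment_algorithm[OF sim n refl, where p = p and \<epsilon> = \<epsilon>]
  let ?R = "replicate_pmf (sample_size p n \<epsilon>) (pmf_of_set {..<n})"
  define M where "M = degree_moment p f \<sigma>"
  \<comment> \<open>With this accuracy the total relative error \<open>error_factor p * h\<close> is
    exactly \<open>\<epsilon>\<close>.\<close>
  define h where "h = \<epsilon> / error_factor p"
  have F: "error_factor p \<ge> 2" using assms by (rule error_factor_ge_2)
  then have h: "0 < h" "h \<le> 1 / 2" and hF: "error_factor p * h = \<epsilon>"
    using e by (auto simp: h_def field_simps)
  have "4 * threshold p n powr p * ln (400 * real n) / h\<^sup>2 \<le> sample_size p n \<epsilon>"
    using real_sample_size(1)[OF assms n(2), of \<epsilon>] F
    by (simp add: h_def power_divide mult_ac)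
  from moment_estimate_concentration[OF assms sim n h this]
  have "0.99 \<le> measure_pmf.prob ?R {xs. \<bar>moment_estimate p f \<sigma> xs - M\<bar> \<le> \<epsilon> * M}"
    by (simp add: hF M_def)
  also have "{xs. \<bar>moment_estimate p f \<sigma> xs - M\<bar> \<le> \<epsilon> * M}
      = moment_estimate p f \<sigma> -` {x. (1 - \<epsilon>) * M \<le> x \<and> x \<le> (1 + \<epsilon>) * M}"
    by (auto simp: abs_le_iff algebra_simps)
  finally show "approximates \<epsilon> 0.01 (map_pmf result (run (moment_algorithm p) f \<epsilon> \<sigma>))
      (degree_moment p f \<sigma>)"
    unfolding approximates_def run(1) by (simp add: M_def)
  fix s assume "n \<ge> 2" and "s \<in> set_pmf (run (moment_algorithm p) f \<epsilon> \<sigma>)"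
  then have "words_used (moment_algorithm p) s \<le> 32 + 2 * sample_size p n \<epsilon>"
    using run(2)[of s] by (simp add: words_used_def counters_moment_algorithm)
  then have "real (words_used (moment_algorithm p) s) \<le> 32 + 2 * real (sample_size p n \<epsilon>)"
    by linarith
  also note space_bound[OF assms \<open>n \<ge> 2\<close> e]
  finally show "real (words_used (moment_algorithm p) s)
    \<le> (80 * (error_factor p)\<^sup>2 + 68) * (1 / \<epsilon>\<^sup>2 * real n powr (1 - 1 / (p + 1)) * ln (real n))" .
qed

end
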